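(* Let $\mathcal{C}\subset\mathbb{R}^d$ be a nonempty compact convex set and $\omega:\mathbb{R}^d\to\mathbb{R}$ a distance function with asymmetry constant $\kappa_\omega$. Let $f$ be a differentiable function that on $\mathcal{C}$ is smooth w.r.t. $\omega$ with constant $L_\omega>0$ and strongly convex w.r.t. $\omega$ with constant $\mu_\omega>0$, and let $\mathcal{C}$ be $\alpha_\omega$-strongly convex w.r.t. $\omega$, $\alpha_\omega>0$. Let $f^*=\min_{\mathcal{C}}f$ and let $x_0\in\mathcal{C}$ with $f(x_0)>f^*$. For $x\in\mathcal{C}$ let $v(x)\in\operatorname{argmin}_{v\in\mathcal{C}}\langle\nabla f(x),v\rangle$ and $\delta(x)=v(x)-x$. Then $f$ is modified directionally smooth w.r.t. $\delta$, and its (smallest) constant satisfies $$\tilde{\mathcal{L}}_{f,\delta}(x_0)\le\frac{\kappa_\omega\sqrt2\,L_\omega}{\alpha_\omega\sqrt{\mu_\omega}}\,\frac{1}{\sqrt{f(x_0)-f^*}};$$ that is, the modified directional smoothness inequality holds with the constant on the right-hand side.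
   Context: Distance function: $\omega:\mathbb{R}^d\to\mathbb{R}$ with (i) $\omega(x)=0\Leftrightarrow x=0$; (ii) $\omega(x)\ge0$; (iii) $\omega(x+y)\le\omega(x)+\omega(y)$; (iv) $\omega(\gamma x)=\gamma\omega(x)$ for $\gamma\ge0$; (v) bounded asymmetry: $\omega(x)\le\kappa_\omega\,\omega(-x)$ for all $x$, for a finite constant $\kappa_\omega$. No symmetry is assumed. $f$ is smooth (resp. strongly convex) w.r.t. $\omega$ on $\mathcal{C}$ with constant $L_\omega$ (resp. $\mu_\omega$) if for all $x,y\in\mathcal{C}$: $f(y)\le f(x)+\langle\nabla f(x),y-x\rangle+\frac{L_\omega}{2}\omega^2(y-x)$ (resp. $f(y)\ge f(x)+\langle\nabla f(x),y-x\rangle+\frac{\mu_\omega}{2}\omega^2(y-x)$). $\mathcal{C}$ is $\alpha_\omega$-strongly convex w.r.t. $\omega$ if for all $x,y\in\mathcal{C}$, all $\gamma\in[0,1]$ and all $z$ with $\omega(z)\le1$, $$\gamma x+(1-\gamma)y+\alpha_\omega\gamma(1-\gamma)\frac{(1-\gamma)\omega^2(x-y)+\gamma\,\omega^2(y-x)}{2}\,z\in\mathcal{C}.$$ Given $x_0\in\mathcal{C}$, $f$ is modified directionally smooth with direction function $\delta:\mathcal{C}\to\mathbb{R}^d$ and constant $\tilde{\mathcal{L}}_{f,\delta}(x_0)>0$ if for all $x\in\mathcal{C}$ with $f(x)>f^*$ and all $0<h<1$, $$f(x+h\delta(x))\le f(x)+h\langle\nabla f(x),\delta(x)\rangle-\frac{\tilde{\mathcal{L}}_{f,\delta}(x_0)\,h^2}{2}\langle\nabla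 f(x),\delta(x)\rangle\sqrt{\frac{f(x_0)-f^*}{f(x)-f^*}}.$$ *)

theory Defs
  imports "HOL-Analysis.Analysis"
begin

text \<open>A possibly asymmetric distance function; \<open>\<kappa>\<close> is any finite constant bounding the
  asymmetry, not necessarily the best one.\<close>

definition distance_function :: "(real ^ 'n \<Rightarrow> real) \<Rightarrow> real \<Rightarrow> bool" where
  "distance_function \<omega> \<kappa> \<longleftrightarrow>
     (\<forall>x. \<omega> x = 0 \<longleftrightarrow> x = 0) \<and>
     (\<forall>x. 0 \<le> \<omega> x) \<and>
     (\<forall>x y. \<omega> (x + y) \<le> \<omega> x + \<omega> y) \<and>
     (\<forall>\<gamma>\<ge>0. \<forall>x. \<omega> (\<gamma> *\<^sub>R x) = \<gamma> * \<omega> x) \<and>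
     (\<forall>x. \<omega> x \<le> \<kappa> * \<omega> (- x))"

text \<open>The derivative is the two-sided one on the whole space, also at boundary points of a
  constraint set, so the gradient is unique wherever it exists.\<close>

definition gradient :: "(real ^ 'n \<Rightarrow> real) \<Rightarrow> real ^ 'n \<Rightarrow> real ^ 'n" where
  "gradient f x = (THE D. GDERIV f x :> D)"

lemma GDERIV_unique:
  fixes f :: "real ^ 'n \<Rightarrow> real"
  assumes "GDERIV f x :> D" and "GDERIV f x :> E"
  shows "D = E"
proof -
  have "(\<lambda>h. inner h D) = (\<lambda>h. inner h E)"
    using assms unfolding gderiv_def by (rule has_derivative_unique)
  then show ?thesis
    using vector_eq_ldot[of D E] by (simp add: fun_eq_iff)
qed

lemma GDERIV_gradient:
  fixes f :: "real ^ 'n \<Rightarrow> real"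
  assumes "f differentiable (at x)"
  shows "GDERIV f x :> gradient f x"
proof -
  obtain f' where f': "(f has_derivative f') (at x)"
    using assms unfolding differentiable_def by blast
  then have lin: "linear f'"
    by (rule has_derivative_linear)
  define D where "D = adjoint f' 1"
  have "f' h = inner h D" for h
    unfolding D_def using adjoint_works[OF lin, of h 1] by simp
  then have "f' = (\<lambda>h. inner h D)"
    by (rule ext)
  then have D: "GDERIV f x :> D"
    using f' unfolding gderiv_def by simp
  show ?thesis
    unfolding gradient_def using D by (rule theI) (rule GDERIV_unique[OF _ D])
qed

definition smooth_wrt ::
    "(real ^ 'n \<Rightarrow> real) \<Rightarrow> (real ^ 'n) set \<Rightarrow> (real ^ 'n \<Rightarrow> real) \<Rightarrow> real \<Rightarrow> bool" where
  "smooth_wrt \<omega> C f L \<longleftrightarrow>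
     (\<forall>x\<in>C. \<forall>y\<in>C. f y \<le> f x + gradient f x \<bullet> (y - x) + L / 2 * (\<omega> (y - x))\<^sup>2)"

definition strongly_convex_fun_wrt ::
    "(real ^ 'n \<Rightarrow> real) \<Rightarrow> (real ^ 'n) set \<Rightarrow> (real ^ 'n \<Rightarrow> real) \<Rightarrow> real \<Rightarrow> bool" where
  "strongly_convex_fun_wrt \<omega> C f \<mu> \<longleftrightarrow>
     (\<forall>x\<in>C. \<forall>y\<in>C. f y \<ge> f x + gradient f x \<bullet> (y - x) + \<mu> / 2 * (\<omega> (y - x))\<^sup>2)"

definition strongly_convex_set_wrt ::
    "(real ^ 'n \<Rightarrow> real) \<Rightarrow> (real ^ 'n) set \<Rightarrow> real \<Rightarrow> bool" where
  "strongly_convex_set_wrt \<omega> C \<alpha> \<longleftrightarrow>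
     (\<forall>x\<in>C. \<forall>y\<in>C. \<forall>\<gamma>\<in>{0..1}. \<forall>z. \<omega> z \<le> 1 \<longrightarrow>
        \<gamma> *\<^sub>R x + (1 - \<gamma>) *\<^sub>R y
          + (\<alpha> * \<gamma> * (1 - \<gamma>)
              * (((1 - \<gamma>) * (\<omega> (x - y))\<^sup>2 + \<gamma> * (\<omega> (y - x))\<^sup>2) / 2)) *\<^sub>R z \<in> C)"

definition min_value :: "(real ^ 'n \<Rightarrow> real) \<Rightarrow> (real ^ 'n) set \<Rightarrow> real" where
  "min_value f C = (LEAST m. m \<in> f ` C)"

definition modified_dir_smooth ::
    "(real ^ 'n \<Rightarrow> real) \<Rightarrow> (real ^ 'n) set \<Rightarrow> (real ^ 'n \<Rightarrow> real ^ 'n) \<Rightarrow> real ^ 'n \<Rightarrow> real \<Rightarrow> bool"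
  where
  "modified_dir_smooth f C \<delta> x0 K \<longleftrightarrow> K > 0 \<and>
     (\<forall>x\<in>C. f x > min_value f C \<longrightarrow> (\<forall>h. 0 < h \<and> h < 1 \<longrightarrow>
        f (x + h *\<^sub>R \<delta> x)
          \<le> f x + h * (gradient f x \<bullet> \<delta> x)
            - K * h\<^sup>2 / 2 * (gradient f x \<bullet> \<delta> x)
                * sqrt ((f x0 - min_value f C) / (f x - min_value f C))))"

text \<open>Whether a smallest constant exists is part of what has to be shown about this value.\<close>

definition modified_dir_smooth_const ::
    "(real ^ 'n \<Rightarrow> real) \<Rightarrow> (real ^ 'n) set \<Rightarrow> (real ^ 'n \<Rightarrow> real ^ 'n) \<Rightarrow> real ^ 'n \<Rightarrow> real" where
  "modified_dir_smooth_const f C \<delta> x0 = (LEAST K. modified_dir_smooth f C \<delta> x0 K)"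

end

theory Submission
  imports Defs
begin

text \<open>
  Write \<open>g\<close> for the gradient at a point \<open>x\<close> of \<open>C\<close> that is not optimal, and \<open>d = \<delta> x\<close>. Two bounds
  for the reversed length \<open>\<omega> (- d)\<close> are played against each other.

  On the one hand, the curvature of \<open>C\<close> makes the linear minimiser \<open>v x = x + d\<close> much better than
  \<open>x\<close>: \<open>- (g \<bullet> d) \<ge> \<alpha> / 2 * (\<omega> (- d))\<^sup>2 * (- (g \<bullet> z))\<close> for every \<open>z\<close> in the unit ball of \<open>\<omega>\<close>
  (\<open>linear_minimiser_gap\<close>). With \<open>z\<close> the direction from \<open>x\<close> to a minimiser of \<open>f\<close>, strong convexity
  of \<open>f\<close> bounds \<open>- (g \<bullet> z)\<close> below by \<open>sqrt (2 * \<mu> * (f x - f\<^sup>*))\<close> (\<open>steep_direction\<close>).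

  On the other hand, \<open>f (x + h *\<^sub>R d) \<le> f x + h * (g \<bullet> d) + L / 2 * h\<^sup>2 * (\<omega> (- d))\<^sup>2\<close>, again with
  the reversed length, since smoothness with respect to \<open>\<omega>\<close> on a convex set implies smoothness with
  respect to the reversed distance, with the same \<open>L\<close> (\<open>smooth_wrt_reverse\<close>). This matters: passing
  from \<open>\<omega> d\<close> to \<open>\<omega> (- d)\<close> by the asymmetry bound would cost a factor \<open>\<kappa>\<^sup>2\<close>, more than the
  theorem grants. The two bounds combine to the claimed constant because \<open>\<kappa> \<ge> 1\<close>
  (\<open>asymmetry_ge_1\<close>).

  A smallest constant exists because the admissible constants form a closed set once they are known
  to stay away from 0; strong convexity of \<open>f\<close> at \<open>x0\<close> supplies that positive lower bound.
\<close>

section \<open>Distance functions\<close>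

lemma
  assumes "distance_function \<omega> \<kappa>"
  shows distance_function_eq_0_iff: "\<omega> x = 0 \<longleftrightarrow> x = 0"
    and distance_function_nonneg: "0 \<le> \<omega> x"
    and distance_function_scale: "0 \<le> c \<Longrightarrow> \<omega> (c *\<^sub>R x) = c * \<omega> x"
    and distance_function_asym: "\<omega> x \<le> \<kappa> * \<omega> (- x)"
  using assms by (auto simp: distance_function_def)

lemma distance_function_pos:
  assumes "distance_function \<omega> \<kappa>" and "x \<noteq> 0"
  shows "0 < \<omega> x"
  using distance_function_eq_0_iff[OF assms(1), of x] distance_function_nonneg[OF assms(1), of x]
    assms(2) by linarith

lemma asymmetry_ge_1:
  fixes \<omega> :: "real ^ 'n \<Rightarrow> real"
  assumes \<omega>: "distance_function \<omega> \<kappa>"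
  shows "1 \<le> \<kappa>"
proof (rule ccontr)
  assume "\<not> 1 \<le> \<kappa>"
  obtain x :: "real ^ 'n" where "x \<noteq> 0"
    by (metis zero_neq_one)
  then have pos: "0 < \<omega> x" "0 < \<omega> (- x)"
    using distance_function_pos[OF \<omega>] by auto
  have "\<omega> x \<le> \<kappa> * \<omega> (- x)" "\<omega> (- x) \<le> \<kappa> * \<omega> x"
    using distance_function_asym[OF \<omega>, of x] distance_function_asym[OF \<omega>, of "- x"] by auto
  moreover have "\<kappa> * \<omega> (- x) < \<omega> (- x)" "\<kappa> * \<omega> x < \<omega> x"
    using pos \<open>\<not> 1 \<le> \<kappa>\<close> by auto
  ultimately show False by linarith
qed

section \<open>Smoothness with respect to the reversed distance\<close>

lemma has_real_derivative_along_line: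
  fixes f :: "real ^ 'n \<Rightarrow> real"
  assumes "f differentiable (at (x + t *\<^sub>R d))"
  shows "((\<lambda>t. f (x + t *\<^sub>R d)) has_real_derivative gradient f (x + t *\<^sub>R d) \<bullet> d) (at t)"
proof -
  have f: "(f has_derivative (\<lambda>k. k \<bullet> gradient f (x + t *\<^sub>R d))) (at (x + t *\<^sub>R d))"
    using GDERIV_gradient[OF assms] unfolding gderiv_def .
  have "((\<lambda>t. x + t *\<^sub>R d) has_derivative (\<lambda>k. k *\<^sub>R d)) (at t)"
    by (auto intro!: derivative_eq_intros)
  from has_derivative_compose[OF this f] show ?thesis
    unfolding has_field_derivative_def
    by (rule has_derivative_eq_rhs) (simp add: fun_eq_iff inner_commute mult.commute)
qed

text \<open>Along a segment, upper bounds that expand at the far end measure the reversed length, and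
  together they yield the bound that expands at the near end: if \<open>\<phi> 0\<close> is bounded by the expansion of \<open>\<phi>\<close>
  at every later point, then the secant slope \<open>(\<phi> s - \<phi> 0) / s\<close> has derivative at most \<open>c / 2\<close>. Its
  growth from \<open>\<phi>' 0\<close> at \<open>s = 0\<close> then bounds \<open>\<phi> 1\<close> by the expansion at 0.\<close>

lemma quadratic_bound_flip:
  fixes \<phi> \<phi>' :: "real \<Rightarrow> real"
  assumes deriv: "\<And>s. 0 \<le> s \<Longrightarrow> s \<le> 1 \<Longrightarrow> (\<phi> has_real_derivative \<phi>' s) (at s)"
    and bound: "\<And>s. 0 < s \<Longrightarrow> s < 1 \<Longrightarrow> \<phi> 0 \<le> \<phi> s - s * \<phi>' s + c / 2 * s\<^sup>2"
  shows "\<phi> 1 \<le> \<phi> 0 + \<phi>' 0 + c / 2"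
proof -
  define Q where "Q s = (if s = 0 then \<phi>' 0 else (\<phi> s - \<phi> 0) / s)" for s
  have Q': "(Q has_real_derivative (\<phi>' s * s - (\<phi> s - \<phi> 0)) / s\<^sup>2) (at s)"
    if s: "0 < s" "s \<le> 1" for s
  proof -
    have "((\<lambda>s. (\<phi> s - \<phi> 0) / s) has_real_derivative (\<phi>' s * s - (\<phi> s - \<phi> 0)) / s\<^sup>2) (at s)"
      using deriv[of s] s by (auto intro!: derivative_eq_intros simp: power2_eq_square)
    then show ?thesis
      by (rule has_field_derivative_transform_within_open[where S = "{0<..}"])
        (use s in \<open>auto simp: Q_def\<close>)
  qed
  have "isCont Q 0"
  proof -
    have "((\<lambda>s. (\<phi> s - \<phi> 0) / s) \<longlongrightarrow> \<phi>' 0) (at 0)"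
      using deriv[of 0] by (simp add: DERIV_def)
    then have "(Q \<longlongrightarrow> \<phi>' 0) (at 0)"
      by (rule Lim_transform_eventually) (simp add: Q_def eventually_at_filter)
    then show ?thesis by (simp add: isCont_def Q_def)
  qed
  then have "continuous_on {0..1} Q"
    by (intro continuous_at_imp_continuous_on ballI)
      (metis DERIV_isCont Q' atLeastAtMost_iff order_le_less)
  moreover have "(Q has_derivative (*) ((\<phi>' s * s - (\<phi> s - \<phi> 0)) / s\<^sup>2)) (at s)"
    if "0 < s" "s < 1" for s
    using Q'[of s] that by (simp add: has_field_derivative_def)
  ultimately obtain s where s: "0 < s" "s < 1"
    and eq: "Q 1 - Q 0 = (\<phi>' s * s - (\<phi> s - \<phi> 0)) / s\<^sup>2"
    using mvt[of 0 1 Q "\<lambda>s. (*) ((\<phi>' s * s - (\<phi> s - \<phi> 0)) / s\<^sup>2)"] by auto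
  have "(\<phi>' s * s - (\<phi> s - \<phi> 0)) / s\<^sup>2 \<le> c / 2"
    using bound[OF s] s by (simp add: pos_divide_le_eq mult.commute)
  with eq have "Q 1 - Q 0 \<le> c / 2" by simp
  then show ?thesis by (simp add: Q_def)
qed

lemma smooth_wrt_reverse:
  fixes f :: "real ^ 'n \<Rightarrow> real"
  assumes \<omega>: "distance_function \<omega> \<kappa>" and "convex C"
    and diff: "\<forall>x\<in>C. f differentiable (at x)" and smooth: "smooth_wrt \<omega> C f L"
  shows "smooth_wrt (\<lambda>x. \<omega> (- x)) C f L"
  unfolding smooth_wrt_def
proof (intro ballI)
  fix x y assume xy: "x \<in> C" "y \<in> C"
  define d where "d = y - x"
  define p where "p s = x + s *\<^sub>R d" for s :: real
  have p_in: "p s \<in> C" if "0 \<le> s" "s \<le> 1" for s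
  proof -
    have "p s = (1 - s) *\<^sub>R x + s *\<^sub>R y"
      by (simp add: p_def d_def scaleR_diff_left scaleR_diff_right)
    then show ?thesis
      using convexD_alt[OF \<open>convex C\<close> xy, of s] that by simp
  qed
  have "f (p 1) \<le> f (p 0) + gradient f (p 0) \<bullet> d + (L * (\<omega> (- d))\<^sup>2) / 2"
  proof (rule quadratic_bound_flip[where \<phi> = "\<lambda>s. f (p s)" and \<phi>' = "\<lambda>s. gradient f (p s) \<bullet> d"])
    fix s :: real assume "0 \<le> s" "s \<le> 1"
    then have "f differentiable (at (p s))"
      using diff p_in by simp
    then show "((\<lambda>s. f (p s)) has_real_derivative gradient f (p s) \<bullet> d) (at s)"
      unfolding p_def by (rule has_real_derivative_along_line)
  next
    fix s :: real assume s: "0 < s" "s < 1"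
    have rev_step: "p 0 - p s = s *\<^sub>R (- d)"
      by (simp add: p_def)
    have "f (p 0) \<le> f (p s) + gradient f (p s) \<bullet> (p 0 - p s) + L / 2 * (\<omega> (p 0 - p s))\<^sup>2"
      using smooth p_in s by (simp add: smooth_wrt_def)
    also have "\<omega> (p 0 - p s) = s * \<omega> (- d)"
      unfolding rev_step using distance_function_scale[OF \<omega>, of s "- d"] s by simp
    finally show "f (p 0) \<le> f (p s) - s * (gradient f (p s) \<bullet> d) + L * (\<omega> (- d))\<^sup>2 / 2 * s\<^sup>2"
      unfolding rev_step by (simp add: power_mult_distrib mult_ac)
  qed
  then show "f y \<le> f x + gradient f x \<bullet> (y - x) + L / 2 * (\<omega> (- (y - x)))\<^sup>2"
    by (simp add: p_def d_def)
qed

section \<open>Linear minimisation and the optimality gap\<close>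

text \<open>Strong convexity of the set allows the point \<open>v + \<gamma> *\<^sub>R (x - v)\<close> to be pushed along \<open>z\<close> without
  leaving \<open>C\<close>, and minimality of \<open>v\<close> bounds the resulting decrease of the linear function. As
  \<open>\<gamma>\<close> tends to 0, only the length of \<open>x - v\<close>, pointing away from \<open>v\<close>, survives.\<close>

lemma linear_minimiser_gap:
  fixes g x v z :: "real ^ 'n"
  assumes sc: "strongly_convex_set_wrt \<omega> C \<alpha>"
    and xv: "x \<in> C" "v \<in> C" and min: "\<And>w. w \<in> C \<Longrightarrow> g \<bullet> v \<le> g \<bullet> w"
    and z: "\<omega> z \<le> 1"
  shows "\<alpha> / 2 * (\<omega> (x - v))\<^sup>2 * (- (g \<bullet> z)) \<le> g \<bullet> (x - v)"
proof -
  define a b where "a = (\<omega> (x - v))\<^sup>2" and "b = (\<omega> (v - x))\<^sup>2"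
  define G where "G \<gamma> = \<alpha> * (1 - \<gamma>) * (((1 - \<gamma>) * a + \<gamma> * b) / 2) * (- (g \<bullet> z))" for \<gamma> :: real
  have G_le: "G \<gamma> \<le> g \<bullet> (x - v)" if \<gamma>: "0 < \<gamma>" "\<gamma> < 1" for \<gamma>
  proof -
    define q where "q = ((1 - \<gamma>) * a + \<gamma> * b) / 2"
    have "\<gamma> *\<^sub>R x + (1 - \<gamma>) *\<^sub>R v + (\<alpha> * \<gamma> * (1 - \<gamma>) * q) *\<^sub>R z \<in> C"
      using sc xv \<gamma> z unfolding strongly_convex_set_wrt_def q_def a_def b_def by auto
    from min[OF this] have "\<gamma> * (\<alpha> * (1 - \<gamma>) * q * (- (g \<bullet> z))) \<le> \<gamma> * (g \<bullet> (x - v))"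
      by (simp add: inner_add_right inner_diff_right algebra_simps)
    then have "\<gamma> * G \<gamma> \<le> \<gamma> * (g \<bullet> (x - v))"
      by (simp only: G_def q_def)
    then show ?thesis using \<gamma> by simp
  qed
  have "(G \<longlongrightarrow> G 0) (at_right 0)"
    unfolding G_def by (intro tendsto_intros) auto
  moreover have "eventually (\<lambda>\<gamma>. G \<gamma> \<le> g \<bullet> (x - v)) (at_right 0)"
    by (rule eventually_at_rightI[of 0 1]) (use G_le in auto)
  ultimately have "G 0 \<le> g \<bullet> (x - v)"
    by (rule tendsto_upperbound) simp
  then show ?thesis by (simp add: G_def a_def)
qed

text \<open>Along the unit vector \<open>z\<close> from \<open>x\<close> to a better point at distance \<open>r\<close>, strong convexity bounds
  the decrease of \<open>f\<close> by \<open>r * m - \<mu> / 2 * r\<^sup>2\<close>, where \<open>m = - (gradient f x \<bullet> z)\<close>, and the maximum of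
  this over \<open>r\<close> is \<open>m\<^sup>2 / (2 * \<mu>)\<close>.\<close>

lemma steep_direction:
  fixes f :: "real ^ 'n \<Rightarrow> real"
  assumes \<omega>: "distance_function \<omega> \<kappa>" and "0 < \<mu>" and sc: "strongly_convex_fun_wrt \<omega> C f \<mu>"
    and xy: "x \<in> C" "y \<in> C" and less: "f y < f x"
  obtains z where "\<omega> z \<le> 1" and "sqrt (2 * \<mu> * (f x - f y)) \<le> - (gradient f x \<bullet> z)"
proof
  define r where "r = \<omega> (y - x)"
  define z where "z = (1 / r) *\<^sub>R (y - x)"
  define m where "m = - (gradient f x \<bullet> z)"
  have r: "0 < r"
    using distance_function_pos[OF \<omega>, of "y - x"] less by (auto simp: r_def)
  then show "\<omega> ((1 / r) *\<^sub>R (y - x)) \<le> 1"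
    using distance_function_scale[OF \<omega>, of "1 / r" "y - x"] by (simp flip: r_def)
  have grad: "gradient f x \<bullet> (y - x) = - (r * m)"
    using r by (simp add: m_def z_def)
  have gap: "f x - f y \<le> r * m - \<mu> / 2 * r\<^sup>2"
    using sc xy unfolding strongly_convex_fun_wrt_def r_def[symmetric] by (smt (verit) grad r_def)
  have "0 < r * m - \<mu> / 2 * r\<^sup>2"
    using gap less by simp
  then have "0 < r * m"
    using \<open>0 < \<mu>\<close> by (smt (verit) divide_pos_pos mult_nonneg_nonneg zero_le_power2)
  then have m: "0 < m"
    using r by (simp add: zero_less_mult_iff)
  have "2 * \<mu> * (f x - f y) \<le> 2 * \<mu> * (r * m - \<mu> / 2 * r\<^sup>2)"
    using gap \<open>0 < \<mu>\<close> by simp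
  also have "\<dots> = m\<^sup>2 - (m - \<mu> * r)\<^sup>2"
    by (simp add: power2_eq_square field_simps)
  also have "\<dots> \<le> m\<^sup>2" by simp
  finally have "sqrt (2 * \<mu> * (f x - f y)) \<le> m"
    using m by (intro real_le_lsqrt) auto
  then show "sqrt (2 * \<mu> * (f x - f y)) \<le> - (gradient f x \<bullet> ((1 / r) *\<^sub>R (y - x)))"
    by (simp add: m_def z_def)
qed

section \<open>The smallest constant\<close>

lemma min_value_attained:
  fixes f :: "real ^ 'n \<Rightarrow> real"
  assumes "compact C" and "C \<noteq> {}" and "continuous_on C f"
  obtains y where "y \<in> C" and "f y = min_value f C" and "\<And>x. x \<in> C \<Longrightarrow> min_value f C \<le> f x"
proof -
  obtain y where y: "y \<in> C" "\<forall>x\<in>C. f y \<le> f x"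
    using continuous_attains_inf[OF assms] by blast
  have "min_value f C = f y"
    unfolding min_value_def by (rule Least_equality) (use y in auto)
  with y that show thesis by metis
qed

text \<open>The inequalities that define an admissible constant are closed conditions on it, apart from its
  positivity; a positive lower bound turns that into a closed condition as well.\<close>

lemma modified_dir_smooth_const_attained:
  assumes K: "modified_dir_smooth f C \<delta> x0 K"
    and "0 < c" and lower: "\<And>K. modified_dir_smooth f C \<delta> x0 K \<Longrightarrow> c \<le> K"
  shows "modified_dir_smooth f C \<delta> x0 (modified_dir_smooth_const f C \<delta> x0)"
    and "modified_dir_smooth_const f C \<delta> x0 \<le> K"
proof -
  define S where "S = {K. modified_dir_smooth f C \<delta> x0 K}"
  define bound where "bound K x h \<longleftrightarrow> f (x + h *\<^sub>R \<delta> x) \<le> f x + h * (gradient f x \<bullet> \<delta> x)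
      - K * h\<^sup>2 / 2 * (gradient f x \<bullet> \<delta> x)
          * sqrt ((f x0 - min_value f C) / (f x - min_value f C))" for K x h
  define A where "A = {x \<in> C. min_value f C < f x}"
  have char: "modified_dir_smooth f C \<delta> x0 K \<longleftrightarrow> 0 < K \<and> (\<forall>x\<in>A. \<forall>h\<in>{0<..<1}. bound K x h)" for K
    unfolding modified_dir_smooth_def bound_def A_def by auto
  have "S = {c..} \<inter> (\<Inter>x\<in>A. \<Inter>h\<in>{0<..<1}. {K. bound K x h})"
    using lower[unfolded char] \<open>0 < c\<close> by (auto simp: S_def char)
  moreover have "closed {K. bound K x h}" for x h
    unfolding bound_def by (intro closed_Collect_le continuous_intros) auto
  ultimately have "closed S"
    by (simp add: closed_Int closed_INT)
  moreover have "bdd_below S"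
    using lower by (auto simp: S_def intro: bdd_belowI[of _ c])
  moreover have "S \<noteq> {}"
    using K by (auto simp: S_def)
  ultimately have "Inf S \<in> S"
    by (intro closed_contains_Inf)
  moreover have "Inf S \<le> K'" if "K' \<in> S" for K'
    using that \<open>bdd_below S\<close> by (rule cInf_lower)
  ultimately have "modified_dir_smooth_const f C \<delta> x0 = Inf S"
    unfolding modified_dir_smooth_const_def S_def by (intro Least_equality) auto
  then show "modified_dir_smooth f C \<delta> x0 (modified_dir_smooth_const f C \<delta> x0)"
    and "modified_dir_smooth_const f C \<delta> x0 \<le> K"
    using \<open>Inf S \<in> S\<close> \<open>\<And>K'. K' \<in> S \<Longrightarrow> Inf S \<le> K'\<close> K by (auto simp: S_def)
qed

section \<open>Modified directional smoothness\<close>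

theorem theoremD4:
  fixes C :: "(real ^ 'n) set"
    and \<omega> f :: "real ^ 'n \<Rightarrow> real"
    and v \<delta> :: "real ^ 'n \<Rightarrow> real ^ 'n"
    and x0 :: "real ^ 'n"
    and \<kappa> L \<mu> \<alpha> fstar K :: real
  assumes "C \<noteq> {}" and "compact C" and "convex C"
    and "distance_function \<omega> \<kappa>"
    and "\<forall>x\<in>C. f differentiable (at x)"
    and "L > 0" and "smooth_wrt \<omega> C f L"
    and "\<mu> > 0" and "strongly_convex_fun_wrt \<omega> C f \<mu>"
    and "\<alpha> > 0" and "strongly_convex_set_wrt \<omega> C \<alpha>"
    and "fstar = min_value f C"
    and "x0 \<in> C" and "f x0 > fstar"
    and "\<forall>x\<in>C. is_arg_min (\<lambda>w. gradient f x \<bullet> w) (\<lambda>w. w \<in> C) (v x)"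
    and "\<forall>x\<in>C. \<delta> x = v x - x"
    and "K = \<kappa> * sqrt 2 * L / (\<alpha> * sqrt \<mu>) * (1 / sqrt (f x0 - fstar))"
  shows "modified_dir_smooth f C \<delta> x0 K
    \<and> modified_dir_smooth f C \<delta> x0 (modified_dir_smooth_const f C \<delta> x0)
    \<and> modified_dir_smooth_const f C \<delta> x0 \<le> K"
proof -
  note \<omega> = assms(4)
  have "continuous_on C f"
    using assms(5) by (intro continuous_at_imp_continuous_on) (auto intro: differentiable_imp_continuous_within)
  from min_value_attained[OF assms(2,1) this] obtain y
    where y: "y \<in> C" "f y = fstar" and fstar_le: "\<And>x. x \<in> C \<Longrightarrow> fstar \<le> f x"
    using assms(12) by metis
  have v: "v x \<in> C" "\<And>w. w \<in> C \<Longrightarrow> gradient f x \<bullet> v x \<le> gradient f x \<bullet> w" if "x \<in> C" for x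
    using assms(15) that unfolding is_arg_min_def by (auto simp: not_less)
  have \<delta>: "\<delta> x = v x - x" if "x \<in> C" for x
    using assms(16) that by blast
  have step: "x + h *\<^sub>R \<delta> x \<in> C" if "x \<in> C" "0 < h" "h < 1" for x and h :: real
    using convexD_alt[OF assms(3) that(1) v(1)[OF that(1)], of h] that
    by (simp add: \<delta> algebra_simps)
  have descent: "gradient f x \<bullet> \<delta> x < 0" if x: "x \<in> C" "fstar < f x" for x
  proof -
    have "f x + gradient f x \<bullet> (y - x) + \<mu> / 2 * (\<omega> (y - x))\<^sup>2 \<le> f y"
      using assms(9) x y unfolding strongly_convex_fun_wrt_def by blast
    moreover have "0 \<le> \<mu> / 2 * (\<omega> (y - x))\<^sup>2"
      using assms(8) by simp
    ultimately have "gradient f x \<bullet> (y - x) < 0"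
      using x y by linarith
    then show ?thesis
      using v(2)[OF x(1) y(1)] by (simp add: \<delta>[OF x(1)] inner_diff_right)
  qed
  have \<kappa>: "1 \<le> \<kappa>"
    using asymmetry_ge_1[OF \<omega>] .
  define \<Delta> where "\<Delta> = f x0 - fstar"
  have \<Delta>: "0 < \<Delta>"
    using assms(14) by (simp add: \<Delta>_def)
  have K_pos: "0 < K"
    unfolding assms(17) using \<kappa> assms(6,8,10,14) by simp
  have K: "modified_dir_smooth f C \<delta> x0 K"
    unfolding modified_dir_smooth_def assms(12)[symmetric]
  proof (intro conjI ballI impI allI)
    fix x and h :: real assume x: "x \<in> C" "fstar < f x" and "0 < h \<and> h < 1"
    then have h: "0 < h" "h < 1" by auto
    define g where "g = - (gradient f x \<bullet> \<delta> x)"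
    define e where "e = f x - fstar"
    have g: "0 < g" and e: "0 < e"
      using descent[OF x] x by (simp_all add: g_def e_def)
    obtain z where z: "\<omega> z \<le> 1" "sqrt (2 * \<mu> * e) \<le> - (gradient f x \<bullet> z)"
      using steep_direction[OF \<omega> assms(8,9) x(1) y(1)] x y unfolding e_def by metis
    have "\<alpha> / 2 * (\<omega> (- \<delta> x))\<^sup>2 * sqrt (2 * \<mu> * e)
        \<le> \<alpha> / 2 * (\<omega> (- \<delta> x))\<^sup>2 * (- (gradient f x \<bullet> z))"
      using z(2) assms(10) by (intro mult_left_mono) auto
    also have "\<dots> \<le> g"
      using linear_minimiser_gap[OF assms(11) x(1) v[OF x(1)] z(1)] x(1)
      by (simp add: g_def \<delta> inner_diff_right)
    also have "\<dots> \<le> \<kappa> * g"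
      using \<kappa> g by simp
    finally have "\<alpha> / 2 * (\<omega> (- \<delta> x))\<^sup>2 * sqrt (2 * \<mu> * e) \<le> \<kappa> * g" .
    moreover have "\<alpha> / 2 * (\<omega> (- \<delta> x))\<^sup>2 * sqrt (2 * \<mu> * e)
        = \<alpha> * sqrt \<mu> * sqrt e / sqrt 2 * (\<omega> (- \<delta> x))\<^sup>2"
      using real_sqrt_mult_self[of 2] by (simp add: real_sqrt_mult field_simps)
    ultimately have "(\<omega> (- \<delta> x))\<^sup>2 \<le> \<kappa> * g / (\<alpha> * sqrt \<mu> * sqrt e / sqrt 2)"
      using assms(8,10) e by (subst pos_le_divide_eq) (auto simp: mult.commute)
    then have "L * (\<omega> (- \<delta> x))\<^sup>2 \<le> L * (\<kappa> * g / (\<alpha> * sqrt \<mu> * sqrt e / sqrt 2))"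
      using assms(6) by (intro mult_left_mono) auto
    also have "\<dots> = K * g * sqrt (\<Delta> / e)"
      unfolding assms(17) \<Delta>_def[symmetric] using \<Delta> by (simp add: real_sqrt_divide)
    finally have key: "L * (\<omega> (- \<delta> x))\<^sup>2 \<le> K * g * sqrt (\<Delta> / e)" .

    have "f (x + h *\<^sub>R \<delta> x) \<le> f x + gradient f x \<bullet> (h *\<^sub>R \<delta> x) + L / 2 * (\<omega> (- (h *\<^sub>R \<delta> x)))\<^sup>2"
      using smooth_wrt_reverse[OF \<omega> assms(3,5,7), unfolded smooth_wrt_def, rule_format,
          OF x(1) step[OF x(1) h]]
      by simp
    also have "\<omega> (- (h *\<^sub>R \<delta> x)) = h * \<omega> (- \<delta> x)"
      using distance_function_scale[OF \<omega>, of h "- \<delta> x"] h by simp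
    also have "L / 2 * (h * \<omega> (- \<delta> x))\<^sup>2 = h\<^sup>2 / 2 * (L * (\<omega> (- \<delta> x))\<^sup>2)"
      by (simp add: power_mult_distrib)
    also have "\<dots> \<le> h\<^sup>2 / 2 * (K * g * sqrt (\<Delta> / e))"
      using key by (intro mult_left_mono) auto
    finally show "f (x + h *\<^sub>R \<delta> x) \<le> f x + h * (gradient f x \<bullet> \<delta> x)
        - K * h\<^sup>2 / 2 * (gradient f x \<bullet> \<delta> x) * sqrt ((f x0 - fstar) / (f x - fstar))"
      by (simp add: g_def e_def \<Delta>_def algebra_simps)
  qed (rule K_pos)

  define g0 where "g0 = - (gradient f x0 \<bullet> \<delta> x0)"
  have g0: "0 < g0"
    using descent[OF assms(13,14)] by (simp add: g0_def)
  then have "\<delta> x0 \<noteq> 0"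
    by (auto simp: g0_def)
  then have pos: "0 < \<mu> * (\<omega> (\<delta> x0))\<^sup>2 / g0"
    using distance_function_pos[OF \<omega>, of "\<delta> x0"] g0 assms(8) by simp
  \<comment> \<open>At \<open>x0\<close> the square root is 1, so a step of any length, here 1/2, separates the
    constant from 0.\<close>
  have lower: "\<mu> * (\<omega> (\<delta> x0))\<^sup>2 / g0 \<le> K'" if K': "modified_dir_smooth f C \<delta> x0 K'" for K'
  proof -
    have half: "x0 + (1 / 2) *\<^sub>R \<delta> x0 \<in> C"
      using step[OF assms(13)] by simp
    have "f x0 + gradient f x0 \<bullet> ((1 / 2) *\<^sub>R \<delta> x0) + \<mu> / 2 * (\<omega> ((1 / 2) *\<^sub>R \<delta> x0))\<^sup>2
        \<le> f (x0 + (1 / 2) *\<^sub>R \<delta> x0)"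
      using assms(9)[unfolded strongly_convex_fun_wrt_def, rule_format, OF assms(13) half] by simp
    also have "\<dots> \<le> f x0 + (1 / 2) * (gradient f x0 \<bullet> \<delta> x0)
        - K' * (1 / 2)\<^sup>2 / 2 * (gradient f x0 \<bullet> \<delta> x0) * sqrt ((f x0 - fstar) / (f x0 - fstar))"
      using conjunct2[OF K'[unfolded modified_dir_smooth_def assms(12)[symmetric]], rule_format,
          OF assms(13,14), of "1 / 2"]
      by simp
    finally have "\<mu> * (\<omega> (\<delta> x0))\<^sup>2 \<le> K' * g0"
      using distance_function_scale[OF \<omega>, of "1 / 2" "\<delta> x0"] assms(14)
      by (simp add: g0_def power2_eq_square)
    then show ?thesis
      using g0 by (simp add: pos_divide_le_eq)
  qed
  show ?thesis
    using K modified_dir_smooth_const_attained[OF K pos lower] by blast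
qed

end
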